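(* Let $f(x)=\frac12 (Ax,x)$, where $A\in\mathbb{R}^{n\times n}$, $A=A^{\top}\succ 0$, with strong convexity parameter $\mu=\lambda_{\min}>0$ and $L=\lambda_{\max}$, where $\lambda_{\min}$ and $\lambda_{\max}$ are the minimum and maximum eigenvalues of $A$, respectively, and let $\kappa=L/\mu$. Consider the Heavy Ball method $$x_{k+1}=x_k-\alpha^* \nabla f(x_k)+\beta^*(x_k-x_{k-1})$$ with the optimal parameters $$\alpha^*=\frac{4}{(\sqrt L+\sqrt\mu)^2},\qquad \beta^*=\left(\frac{\sqrt L-\sqrt\mu}{\sqrt L+\sqrt\mu}\right)^2 .$$ Then the initial conditions $x_0=-e_1$, $x_1=e_1\in\mathbb{R}^n$, $\|x_0\|=\|x_1\|=1$, cause a peak effect in the method: $$\max_k \|x_k\|\ \ge\ \frac{\sqrt\kappa}{2e},$$ while the standard initial conditions (those with $x_1=x_0$) $x_0=x_1=e_n\in\mathbb{R}^n$, $\|x_0\|=\|x_1\|=1$, cause the same peak effect combined with oscillating behavior.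
   Context: $(\cdot,\cdot)$ and $\|\cdot\|$ are the Euclidean inner product and norm on $\mathbb{R}^n$; $\nabla f(x)=Ax$, and the minimizer of $f$ is $x^*=0$. The vectors $e_1,e_n$ are unit eigenvectors of $A$ with $Ae_1=\mu e_1$ and $Ae_n=Le_n$. In $\sqrt\kappa/(2e)$, $e$ denotes the base of the natural logarithm. A peak effect means that the iterates become large although the initial points have norm $1$; here it is expressed by the displayed lower bound. "Oscillating behavior" is used informally and is not quantified in the statement. The estimates are provided for the case of large condition number $\kappa=L/\mu$. *)

theory Defs
  imports "HOL-Analysis.Analysis"
begin

definition eigenvalues :: "real^'n^'n \<Rightarrow> real set" where
  "eigenvalues A = {c. \<exists>v. v \<noteq> 0 \<and> A *v v = c *\<^sub>R v}"

definition lambda_min :: "real^'n^'n \<Rightarrow> real" where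
  "lambda_min A = Min (eigenvalues A)"

definition lambda_max :: "real^'n^'n \<Rightarrow> real" where
  "lambda_max A = Max (eigenvalues A)"

(* Min and Max are only meaningful on finite sets. *)
lemma finite_eigenvalues:
  fixes A :: "real^'n^'n"
  assumes sym: "transpose A = A"
  shows "finite (eigenvalues A)"
proof -
  define v where "v c = (SOME v. v \<noteq> 0 \<and> A *v v = c *\<^sub>R v)" for c
  have v: "v c \<noteq> 0 \<and> A *v v c = c *\<^sub>R v c" if "c \<in> eigenvalues A" for c
    using that someI_ex[of "\<lambda>v. v \<noteq> 0 \<and> A *v v = c *\<^sub>R v"]
    unfolding eigenvalues_def v_def by blast
  have orth: "orthogonal (v c) (v d)"
    if c: "c \<in> eigenvalues A" and d: "d \<in> eigenvalues A" and "c \<noteq> d" for c d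
  proof -
    have "(A *v v c) \<bullet> v d = v c \<bullet> (A *v v d)"
      by (metis dot_lmul_matrix sym vector_transpose_matrix)
    then have "c * (v c \<bullet> v d) = d * (v c \<bullet> v d)"
      using v[OF c] v[OF d] by simp
    then show ?thesis
      using \<open>c \<noteq> d\<close> by (simp add: orthogonal_def)
  qed
  have "pairwise orthogonal (v ` eigenvalues A)"
    unfolding pairwise_def using orth by blast
  then have "finite (v ` eigenvalues A)"
    by (rule pairwise_orthogonal_imp_finite)
  moreover have "inj_on v (eigenvalues A)"
    by (rule inj_onI) (metis orth orthogonal_self v)
  ultimately show ?thesis
    by (rule finite_imageD)
qed

definition positive_definite :: "real^'n^'n \<Rightarrow> bool" where
  "positive_definite A \<longleftrightarrow> (\<forall>x. x \<noteq> 0 \<longrightarrow> (A *v x) \<bullet> x > 0)"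

definition gradient :: "('a::real_inner \<Rightarrow> real) \<Rightarrow> 'a \<Rightarrow> 'a" where
  "gradient f x = (THE D. GDERIV f x :> D)"

lemma gradient_eq:
  assumes "GDERIV f x :> D"
  shows "gradient f x = D"
  unfolding gradient_def
proof (rule the_equality)
  show "GDERIV f x :> D" by (rule assms)
next
  fix E assume "GDERIV f x :> E"
  then have "(\<lambda>h. h \<bullet> E) = (\<lambda>h. h \<bullet> D)"
    using assms unfolding gderiv_def by (rule has_derivative_unique)
  then show "E = D"
    by (metis vector_eq_ldot)
qed

fun heavy_ball :: "('a::real_inner \<Rightarrow> real) \<Rightarrow> real \<Rightarrow> real \<Rightarrow> 'a \<Rightarrow> 'a \<Rightarrow> nat \<Rightarrow> 'a" where
  "heavy_ball f \<alpha> \<beta> x0 x1 0 = x0"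
| "heavy_ball f \<alpha> \<beta> x0 x1 (Suc 0) = x1"
| "heavy_ball f \<alpha> \<beta> x0 x1 (Suc (Suc k)) =
     heavy_ball f \<alpha> \<beta> x0 x1 (Suc k)
     - \<alpha> *\<^sub>R gradient f (heavy_ball f \<alpha> \<beta> x0 x1 (Suc k))
     + \<beta> *\<^sub>R (heavy_ball f \<alpha> \<beta> x0 x1 (Suc k) - heavy_ball f \<alpha> \<beta> x0 x1 k)"

(* The maximum of the norms over all iterates exists and is at least c. *)
definition peak_effect :: "(nat \<Rightarrow> 'a::real_normed_vector) \<Rightarrow> real \<Rightarrow> bool" where
  "peak_effect x c \<longleftrightarrow> (\<exists>m. (\<forall>k. norm (x k) \<le> norm (x m)) \<and> norm (x m) \<ge> c)"

(* The component along v changes sign at every step.  The index starts at 1 because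
   the two initial points of the method may coincide. *)
definition oscillates_along :: "'a::real_inner \<Rightarrow> (nat \<Rightarrow> 'a) \<Rightarrow> bool" where
  "oscillates_along v x \<longleftrightarrow> (\<forall>k\<ge>1. (x k \<bullet> v) * (x (Suc k) \<bullet> v) < 0)"

end

theory Submission
  imports Defs
begin

text \<open>
  An eigenvector \<open>v\<close> of \<open>A\<close> with eigenvalue \<open>\<lambda>\<close> spans a line that the method never leaves, and on
  it the method is the scalar recurrence \<open>\<xi> (k+2) = (1 + \<beta> - \<alpha> \<lambda>) \<xi> (k+1) - \<beta> \<xi> k\<close>.  Put
  \<open>q = (sqrt L - sqrt \<mu>) / (sqrt L + sqrt \<mu>)\<close>, so that \<open>\<beta> = q\<^sup>2\<close>.  The optimal parameters make both
  ends of the spectrum critically damped: \<open>1 + \<beta> - \<alpha> \<lambda>\<close> is \<open>2 q\<close> for \<open>\<lambda> = \<mu>\<close> and \<open>- 2 q\<close> for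
  \<open>\<lambda> = L\<close>, so the characteristic polynomial has the double root \<open>q\<close>, respectively \<open>- q\<close>.  A double
  root brings in a factor linear in the step, and with the given initial points both cases read
  \<open>x (j+1) = (\<sigma> q) ^ j (1 + j (1 + q)) v\<close> with \<open>\<sigma> = 1\<close> or \<open>\<sigma> = - 1\<close>
  (lemma \<open>heavy_ball_critically_damped\<close>).  The two runs therefore have the same norms, and the
  second one alternates in sign as soon as \<open>q > 0\<close>.

  It remains to study \<open>q ^ j (1 + j (1 + q))\<close>.  It tends to \<open>0\<close>, so a largest value exists.
  With \<open>r = sqrt \<kappa>\<close> one has \<open>q = (r - 1) / (r + 1)\<close>.  During the first \<open>(r - 1) / 2\<close> steps the
  power \<open>q ^ j\<close> stays above \<open>1 / e\<close>, while by then the linear factor has grown to about \<open>r\<close>; the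
  spare factor \<open>2\<close> absorbs the rounding of the step number (lemma \<open>envelope_peak\<close>).
\<close>

lemma gradient_quadratic_form:
  fixes A :: "real^'n^'n"
  assumes "transpose A = A"
  shows "gradient (\<lambda>x. 1/2 * ((A *v x) \<bullet> x)) x = A *v x"
proof (rule gradient_eq)
  have sym: "(A *v h) \<bullet> x = h \<bullet> (A *v x)" for h
    by (metis assms dot_lmul_matrix vector_transpose_matrix)
  have "((*v) A has_derivative (*v) A) (at x)"
    by (simp add: bounded_linear_imp_has_derivative)
  then have "((\<lambda>x. 1/2 * ((A *v x) \<bullet> x)) has_derivative
      (\<lambda>h. 1/2 * ((A *v x) \<bullet> h + (A *v h) \<bullet> x))) (at x)"
    by (auto intro!: derivative_eq_intros)
  moreover have "(\<lambda>h. 1/2 * ((A *v x) \<bullet> h + (A *v h) \<bullet> x)) = (\<lambda>h. h \<bullet> (A *v x))"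
  proof
    fix h
    have "(A *v x) \<bullet> h = h \<bullet> (A *v x)" by (rule inner_commute)
    then show "1/2 * ((A *v x) \<bullet> h + (A *v h) \<bullet> x) = h \<bullet> (A *v x)"
      unfolding sym[of h] by (simp only:) simp
  qed
  ultimately show "GDERIV (\<lambda>x. 1/2 * ((A *v x) \<bullet> x)) x :> A *v x"
    by (simp add: gderiv_def)
qed

definition envelope :: "real \<Rightarrow> nat \<Rightarrow> real" where
  "envelope q j = q ^ j * (1 + real j * (1 + q))"

lemma envelope_nonneg: "0 \<le> q \<Longrightarrow> 0 \<le> envelope q j"
  by (simp add: envelope_def)

lemma envelope_pos: "0 < q \<Longrightarrow> 0 < envelope q j"
  by (simp add: envelope_def add_pos_nonneg)

lemma envelope_tendsto_0:
  assumes "0 \<le> q" "q < 1"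
  shows "envelope q \<longlonglongrightarrow> 0"
proof -
  have "(\<lambda>j. q ^ j + (1 + q) * (real j * q ^ j)) \<longlonglongrightarrow> 0 + (1 + q) * 0"
    using assms by (intro tendsto_intros LIMSEQ_realpow_zero powser_times_n_limit_0) auto
  then show ?thesis
    by (simp add: envelope_def[abs_def] algebra_simps)
qed

text \<open>
  From \<open>1 / q = 1 + 2 / (r - 1) \<le> exp (2 / (r - 1))\<close> it follows that \<open>q ^ j \<ge> 1 / e\<close> as long as
  \<open>j \<le> (r - 1) / 2\<close>.  The largest such \<open>j\<close> exceeds \<open>(r - 3) / 2\<close>, and then the linear factor
  is at least \<open>r / 2\<close> whenever \<open>r\<^sup>2 - 5 r + 2 \<ge> 0\<close>, in particular for \<open>r \<ge> 5\<close>.  For smaller \<open>r\<close>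
  the claimed bound is at most \<open>1\<close>, because \<open>e \<ge> 5 / 2\<close>, and \<open>j = 0\<close> reaches it.
\<close>

lemma envelope_peak:
  assumes "1 \<le> r" and q: "q = (r - 1) / (r + 1)"
  shows "\<exists>j. r / (2 * exp 1) \<le> envelope q j"
proof (cases "r \<le> 5")
  case True
  have "5/2 \<le> exp (1::real)"
    using exp_lower_Taylor_quadratic[of 1] by simp
  with True have "r / (2 * exp 1) \<le> envelope q 0"
    by (simp add: envelope_def)
  then show ?thesis ..
next
  case False
  define d where "d = (r - 1) / 2"
  define j where "j = nat \<lfloor>d\<rfloor>"
  have d: "2 < d" using False by (simp add: d_def)
  have j: "d - 1 < real j" "real j \<le> d"
    using d unfolding j_def by linarith+
  have "0 < q" using False by (simp add: q)
  have "1 / q = 1 + 1 / d"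
    using False by (simp add: q d_def field_simps)
  also have "\<dots> \<le> exp (1 / d)" by (rule exp_ge_add_one_self)
  finally have "(1 / q) ^ j \<le> exp (1 / d) ^ j"
    using \<open>0 < q\<close> by (intro power_mono) auto
  also have "\<dots> = exp (real j / d)"
    by (simp add: exp_of_nat_mult[symmetric])
  also have "\<dots> \<le> exp 1"
    using j d by simp
  finally have pow: "1 / exp 1 \<le> q ^ j"
    using \<open>0 < q\<close> by (simp add: field_simps)
  have "0 \<le> r * (r - 5) + 2" using False by simp
  then have "r / 2 \<le> 1 + (d - 1) * (1 + q)"
    using False by (simp add: q d_def field_simps)
  also have "\<dots> \<le> 1 + real j * (1 + q)"
    using j \<open>0 < q\<close> by (intro add_left_mono mult_right_mono) auto
  finally have lin: "r / 2 \<le> 1 + real j * (1 + q)" .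
  have "r / (2 * exp 1) = 1 / exp 1 * (r / 2)" by simp
  also have "\<dots> \<le> envelope q j"
    unfolding envelope_def using pow lin False \<open>0 < q\<close>
    by (intro mult_mono) auto
  finally show ?thesis ..
qed

text \<open>
  Past some step all values lie below a fixed positive one, so only finitely many compete for the
  maximum.
\<close>

lemma attains_max_if_tendsto_0:
  fixes h :: "nat \<Rightarrow> real"
  assumes "h \<longlonglongrightarrow> 0" and "0 < h n"
  shows "\<exists>m. \<forall>k. h k \<le> h m"
proof -
  obtain N where N: "\<And>k. k \<ge> N \<Longrightarrow> h k < h n"
    using order_tendstoD(2)[OF assms] by (auto simp: eventually_sequentially)
  define M where "M = Max (h ` {..max N n})"
  have M: "h k \<le> M" if "k \<le> max N n" for k
    unfolding M_def using that by (intro Max_ge) auto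
  have "M \<in> h ` {..max N n}"
    unfolding M_def by (intro Max_in) auto
  then obtain m where "M = h m" by auto
  moreover have "h k \<le> M" for k
  proof (cases "k \<le> max N n")
    case False
    then have "h k < h n" by (intro N) simp
    also have "h n \<le> M" by (rule M) simp
    finally show ?thesis by simp
  qed (rule M)
  ultimately show ?thesis by auto
qed

lemma peak_effect_of_envelope:
  assumes "1 \<le> r" and q: "q = (r - 1) / (r + 1)"
    and x0: "norm (x 0) = 1" and x: "\<And>j. norm (x (Suc j)) = envelope q j"
  shows "peak_effect x (r / (2 * exp 1))"
proof -
  have q01: "0 \<le> q" "q < 1"
    using \<open>1 \<le> r\<close> by (simp_all add: q)
  have "(\<lambda>k. norm (x (Suc k))) \<longlonglongrightarrow> 0"
    using envelope_tendsto_0[OF q01] by (simp add: x)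
  then have "(\<lambda>k. norm (x k)) \<longlonglongrightarrow> 0"
    by (rule LIMSEQ_imp_Suc)
  then obtain m where m: "\<forall>k. norm (x k) \<le> norm (x m)"
    using attains_max_if_tendsto_0[of "\<lambda>k. norm (x k)" 0] x0 by auto
  obtain j where "r / (2 * exp 1) \<le> norm (x (Suc j))"
    using envelope_peak[OF assms(1,2)] by (auto simp: x)
  with m show ?thesis
    unfolding peak_effect_def by (meson order_trans)
qed

text \<open>
  The hypothesis on \<open>1 + q\<^sup>2 - \<alpha> * c\<close>, together with \<open>\<sigma>\<^sup>2 = 1\<close>, says that the
  characteristic polynomial of the recurrence on the line through \<open>v\<close> is \<open>(t - \<sigma> q)\<^sup>2\<close>.  For
  \<open>q > 0\<close> the initial point \<open>- \<sigma> v\<close> is opposite in sign to the one that the pure mode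
  \<open>(\<sigma> q) ^ k\<close> would need, and this excites the linearly growing factor.  The parameter \<open>\<sigma>\<close> serves
  to treat both ends of the spectrum at once.  The index is shifted by one so that the formula
  also covers \<open>q = 0\<close>.
\<close>

lemma heavy_ball_critically_damped:
  fixes v :: "'a::real_inner"
  assumes grad: "\<And>t. gradient f (t *\<^sub>R v) = (t * c) *\<^sub>R v"
    and damp: "1 + q\<^sup>2 - \<alpha> * c = 2 * \<sigma> * q" and \<sigma>: "\<sigma>\<^sup>2 = 1"
  shows "heavy_ball f \<alpha> (q\<^sup>2) (- \<sigma> *\<^sub>R v) v (Suc j) = (\<sigma> ^ j * envelope q j) *\<^sub>R v"
proof -
  let ?x = "heavy_ball f \<alpha> (q\<^sup>2) (- \<sigma> *\<^sub>R v) v"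
  have step: "?x (Suc (Suc k)) = (2 * \<sigma> * q * s - q\<^sup>2 * t) *\<^sub>R v"
    if "?x (Suc k) = s *\<^sub>R v" "?x k = t *\<^sub>R v" for k s t
  proof -
    have "?x (Suc (Suc k)) = ((1 + q\<^sup>2 - \<alpha> * c) * s - q\<^sup>2 * t) *\<^sub>R v"
      using that by (simp add: grad algebra_simps)
    then show ?thesis by (simp only: damp)
  qed
  have "?x (Suc j) = (\<sigma> ^ j * envelope q j) *\<^sub>R v
      \<and> ?x (Suc (Suc j)) = (\<sigma> ^ Suc j * envelope q (Suc j)) *\<^sub>R v"
  proof (induction j)
    case 0
    have "?x (Suc (Suc 0)) = (2 * \<sigma> * q * 1 - q\<^sup>2 * (- \<sigma>)) *\<^sub>R v"
      by (rule step) auto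
    then show ?case
      by (simp add: envelope_def algebra_simps power2_eq_square)
  next
    case (Suc j)
    have "2 * \<sigma> * q * (\<sigma> ^ Suc j * envelope q (Suc j)) - q\<^sup>2 * (\<sigma> ^ j * envelope q j)
        = \<sigma> ^ j * (2 * \<sigma>\<^sup>2 * q * envelope q (Suc j) - q\<^sup>2 * envelope q j)"
      by (simp add: algebra_simps power2_eq_square)
    also have "\<dots> = \<sigma> ^ j * (\<sigma>\<^sup>2 * envelope q (Suc (Suc j)))"
      unfolding \<sigma> by (simp add: envelope_def algebra_simps power2_eq_square)
    finally have "2 * \<sigma> * q * (\<sigma> ^ Suc j * envelope q (Suc j)) - q\<^sup>2 * (\<sigma> ^ j * envelope q j)
        = \<sigma> ^ Suc (Suc j) * envelope q (Suc (Suc j))"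
      by (simp add: power2_eq_square)
    with Suc step show ?case by metis
  qed
  then show ?thesis ..
qed

theorem theorem1:
  fixes A :: "real^'n^'n" and f :: "real^'n \<Rightarrow> real"
    and e1 en :: "real^'n" and \<mu> L \<kappa> \<alpha> \<beta> :: real
  assumes "transpose A = A" and "positive_definite A"
    and "f = (\<lambda>x. 1/2 * ((A *v x) \<bullet> x))"
    and "\<mu> = lambda_min A" and "L = lambda_max A" and "\<kappa> = L / \<mu>"
    and "\<alpha> = 4 / (sqrt L + sqrt \<mu>)\<^sup>2"
    and "\<beta> = ((sqrt L - sqrt \<mu>) / (sqrt L + sqrt \<mu>))\<^sup>2"
    and "norm e1 = 1" and "A *v e1 = \<mu> *\<^sub>R e1"
    and "norm en = 1" and "A *v en = L *\<^sub>R en"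
  shows "peak_effect (heavy_ball f \<alpha> \<beta> (- e1) e1) (sqrt \<kappa> / (2 * exp 1))
    \<and> peak_effect (heavy_ball f \<alpha> \<beta> en en) (sqrt \<kappa> / (2 * exp 1))
    \<and> (\<kappa> > 1 \<longrightarrow> oscillates_along en (heavy_ball f \<alpha> \<beta> en en))"
proof -
  have "e1 \<noteq> 0" using \<open>norm e1 = 1\<close> by auto
  then have "(A *v e1) \<bullet> e1 > 0"
    using \<open>positive_definite A\<close> unfolding positive_definite_def by blast
  then have "\<mu> > 0"
    using \<open>norm e1 = 1\<close> \<open>A *v e1 = \<mu> *\<^sub>R e1\<close> by (simp add: dot_square_norm)
  have "\<mu> \<in> eigenvalues A"
    unfolding eigenvalues_def using \<open>e1 \<noteq> 0\<close> \<open>A *v e1 = \<mu> *\<^sub>R e1\<close> by blast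
  then have "\<mu> \<le> L"
    unfolding \<open>L = lambda_max A\<close> lambda_max_def
    by (intro Max_ge finite_eigenvalues[OF \<open>transpose A = A\<close>])
  define q where "q = (sqrt L - sqrt \<mu>) / (sqrt L + sqrt \<mu>)"
  have \<beta>: "\<beta> = q\<^sup>2" using assms(8) by (simp add: q_def)
  have pos: "sqrt \<mu> > 0" "sqrt L \<ge> sqrt \<mu>"
    using \<open>\<mu> > 0\<close> \<open>\<mu> \<le> L\<close> by auto
  have sq: "L = (sqrt L)\<^sup>2" "\<mu> = (sqrt \<mu>)\<^sup>2"
    using \<open>\<mu> > 0\<close> \<open>\<mu> \<le> L\<close> by auto
  have \<kappa>: "sqrt \<kappa> = sqrt L / sqrt \<mu>"
    by (simp add: \<open>\<kappa> = L / \<mu>\<close> real_sqrt_divide)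
  have "1 \<le> sqrt \<kappa>" using pos by (simp add: \<kappa>)
  have "sqrt \<kappa> - 1 = (sqrt L - sqrt \<mu>) / sqrt \<mu>" "sqrt \<kappa> + 1 = (sqrt L + sqrt \<mu>) / sqrt \<mu>"
    using pos by (simp_all add: \<kappa> diff_divide_distrib add_divide_distrib)
  then have q: "q = (sqrt \<kappa> - 1) / (sqrt \<kappa> + 1)"
    using pos by (simp add: q_def)
  have "0 \<le> q" using \<open>1 \<le> sqrt \<kappa>\<close> by (simp add: q)
  have damp: "1 + q\<^sup>2 - \<alpha> * \<mu> = 2 * 1 * q" "1 + q\<^sup>2 - \<alpha> * L = 2 * (-1) * q"
  proof -
    define s m where "s = sqrt L" and "m = sqrt \<mu>"
    have sm: "s + m \<noteq> 0" using pos unfolding s_def m_def by linarith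
    have q': "q = (s - m) * (s + m) / (s + m)\<^sup>2" "q\<^sup>2 = (s - m)\<^sup>2 / (s + m)\<^sup>2"
      using sm by (simp_all add: q_def s_def m_def power2_eq_square)
    have one: "1 = (s + m)\<^sup>2 / (s + m)\<^sup>2" using sm by simp
    have \<alpha>': "\<alpha> * \<mu> = 4 * m\<^sup>2 / (s + m)\<^sup>2" "\<alpha> * L = 4 * s\<^sup>2 / (s + m)\<^sup>2"
      using sq assms(7) by (simp_all add: s_def m_def)
    have "1 + q\<^sup>2 - \<alpha> * \<mu> = ((s + m)\<^sup>2 + (s - m)\<^sup>2 - 4 * m\<^sup>2) / (s + m)\<^sup>2"
      unfolding \<alpha>' q'(2) by (subst one) (simp add: add_divide_distrib diff_divide_distrib)
    also have "\<dots> = 2 * 1 * q"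
      unfolding q'(1) by (simp add: power2_eq_square algebra_simps)
    finally show "1 + q\<^sup>2 - \<alpha> * \<mu> = 2 * 1 * q" .
    have "1 + q\<^sup>2 - \<alpha> * L = ((s + m)\<^sup>2 + (s - m)\<^sup>2 - 4 * s\<^sup>2) / (s + m)\<^sup>2"
      unfolding \<alpha>' q'(2) by (subst one) (simp add: add_divide_distrib diff_divide_distrib)
    also have "\<dots> = (2 * (-1) * ((s - m) * (s + m))) / (s + m)\<^sup>2"
      by (simp add: power2_eq_square algebra_simps)
    also have "\<dots> = 2 * (-1) * q"
      unfolding q'(1) by simp
    finally show "1 + q\<^sup>2 - \<alpha> * L = 2 * (-1) * q" .
  qed
  have grad: "gradient f x = A *v x" for x
    unfolding assms(3) by (rule gradient_quadratic_form[OF assms(1)])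
  have low: "heavy_ball f \<alpha> \<beta> (- e1) e1 (Suc j) = envelope q j *\<^sub>R e1" for j
    using heavy_ball_critically_damped[of f e1 \<mu> q \<alpha> 1 j] damp(1)
    by (simp add: grad matrix_vector_mult_scaleR assms(10) \<beta>)
  have high: "heavy_ball f \<alpha> \<beta> en en (Suc j) = ((-1) ^ j * envelope q j) *\<^sub>R en" for j
    using heavy_ball_critically_damped[of f en L q \<alpha> "-1" j] damp(2)
    by (simp add: grad matrix_vector_mult_scaleR assms(12) \<beta>)
  have "peak_effect (heavy_ball f \<alpha> \<beta> (- e1) e1) (sqrt \<kappa> / (2 * exp 1))"
    by (rule peak_effect_of_envelope[OF \<open>1 \<le> sqrt \<kappa>\<close> q])
      (simp_all add: low assms(9) envelope_nonneg[OF \<open>0 \<le> q\<close>])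
  moreover have "peak_effect (heavy_ball f \<alpha> \<beta> en en) (sqrt \<kappa> / (2 * exp 1))"
    by (rule peak_effect_of_envelope[OF \<open>1 \<le> sqrt \<kappa>\<close> q])
      (simp_all add: high assms(11) abs_mult power_abs envelope_nonneg[OF \<open>0 \<le> q\<close>])
  moreover have "oscillates_along en (heavy_ball f \<alpha> \<beta> en en)" if "\<kappa> > 1"
    unfolding oscillates_along_def
  proof (intro allI impI)
    fix k :: nat assume "1 \<le> k"
    then obtain j where k: "k = Suc j" by (cases k) auto
    have "1 < sqrt \<kappa>" using that by simp
    then have "0 < q" unfolding q by (intro divide_pos_pos) linarith+
    have "en \<bullet> en = 1" using assms(11) by (simp add: dot_square_norm)
    then have "(heavy_ball f \<alpha> \<beta> en en k \<bullet> en) * (heavy_ball f \<alpha> \<beta> en en (Suc k) \<bullet> en)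
        = - (((-1) ^ j * (-1) ^ j) * (envelope q j * envelope q (Suc j)))"
      unfolding k high by (simp add: algebra_simps)
    also have "\<dots> = - (envelope q j * envelope q (Suc j))"
      by (simp add: power_mult_distrib[symmetric])
    also have "\<dots> < 0"
      using envelope_pos[OF \<open>0 < q\<close>] by simp
    finally show "(heavy_ball f \<alpha> \<beta> en en k \<bullet> en) * (heavy_ball f \<alpha> \<beta> en en (Suc k) \<bullet> en) < 0" .
  qed
  ultimately show ?thesis by blast
qed

end
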